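(* Let $n\ge5$, let $m=4k$ with $k\in\mathbb{N}$, $k\ge1$, and let $r_3,\dots,r_{n-1}$ be pairwise distinct integers. Let $(\lambda_1,\dots,\lambda_n)$ be one of the following two sequences: (a) $(m,\,2m-2,\,2m+2r_3,\dots,2m+2r_{n-1},\,3m-2)$, where $0\le r_j\le m-1$ and $r_j\neq\frac m2-1$ for all $j$; (b) $(m+2,\,2m+2,\,2m+2r_3,\dots,2m+2r_{n-1},\,3m+2)$, where $0\le r_j\le m+2$, $r_j\ne1$ and $r_j\ne\frac m2+1$ for all $j$. Put $\mathcal{L}_i=V_{\lambda_i}$ and let $\mathcal{L}=\mathfrak{sl}_2\ltimes\big(\bigoplus_{i=1}^n\mathcal{L}_i\big)$ be the Lie algebra in which $\mathfrak{sl}_2$ acts on each $\mathcal{L}_i$ by its module structure and the only nonzero brackets among the $\mathcal{L}_i$ are $$[\mathcal{L}_1,\mathcal{L}_1]=\mathcal{L}_2,\quad[\mathcal{L}_1,\mathcal{L}_2]=\mathcal{L}_n,\quad[\mathcal{L}_j,\mathcal{L}_j]=\mathcal{L}_n=[\mathcal{L}_1,\mathcal{L}_j]\quad(3\le j\le n-1).$$ Then $H^2(\mathcal{L},\mathcal{L})\neq0$.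
   Context: All Lie algebras are finite-dimensional over $\mathbb{C}$. $V_\lambda$ denotes the irreducible $\mathfrak{sl}_2$-module of highest weight $\lambda$ (dimension $\lambda+1$). The notation $[\mathcal{L}_i,\mathcal{L}_j]=\mathcal{L}_k$ means that the restriction of the bracket to $\mathcal{L}_i\times\mathcal{L}_j$ is a nonzero $\mathfrak{sl}_2$-equivariant bilinear map with image spanning $\mathcal{L}_k$ (alternating if $i=j$). $H^2(\mathcal{L},\mathcal{L})$ is the second Chevalley–Eilenberg cohomology with coefficients in the adjoint module. *)

theory Defs
  imports "HOL-Analysis.Analysis"
begin

section \<open>Lie algebras and modules over the complex numbers\<close>

locale lie_algebra = vector_space vscale
  for vscale :: "complex \<Rightarrow> 'a::ab_group_add \<Rightarrow> 'a" +
  fixes br :: "'a \<Rightarrow> 'a \<Rightarrow> 'a"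
  assumes finite_dim: "\<exists>B. finite B \<and> span B = UNIV"
    and br_linear_left: "\<And>y. Vector_Spaces.linear vscale vscale (\<lambda>x. br x y)"
    and br_linear_right: "\<And>x. Vector_Spaces.linear vscale vscale (br x)"
    and br_self: "\<And>x. br x x = 0"
    and jacobi: "\<And>x y z. br x (br y z) + br y (br z x) + br z (br x y) = 0"

locale lie_module = G: lie_algebra gscale br + M: vector_space vscale
  for gscale :: "complex \<Rightarrow> 'g::ab_group_add \<Rightarrow> 'g"
    and br :: "'g \<Rightarrow> 'g \<Rightarrow> 'g"
    and vscale :: "complex \<Rightarrow> 'v::ab_group_add \<Rightarrow> 'v" +
  fixes act :: "'g \<Rightarrow> 'v \<Rightarrow> 'v"
  assumes act_linear_left: "\<And>v. Vector_Spaces.linear gscale vscale (\<lambda>x. act x v)"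
    and act_linear_right: "\<And>x. Vector_Spaces.linear vscale vscale (act x)"
    and act_br: "\<And>x y v. act (br x y) v = act x (act y v) - act y (act x v)"

lemma (in lie_algebra) br_skew: "br x y = - br y x"
proof -
  interpret l: Vector_Spaces.linear vscale vscale "br z" for z by (rule br_linear_right)
  interpret r: Vector_Spaces.linear vscale vscale "\<lambda>x. br x z" for z by (rule br_linear_left)
  have "br (x + y) (x + y) = (br x x + br y x) + (br x y + br y y)"
    by (simp only: l.add r.add)
  then have "br x y + br y x = 0"
    by (simp add: br_self add.commute)
  then show ?thesis
    by (simp only: eq_neg_iff_add_eq_0)
qed

lemma (in lie_algebra) adjoint_module: "lie_module vscale br vscale br"
proof unfold_locales
  fix x y v
  interpret l: Vector_Spaces.linear vscale vscale "br z" for z by (rule br_linear_right)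
  show "br (br x y) v = br x (br y v) - br y (br x v)"
    using jacobi[of x y v] br_skew[of v x] br_skew[of v "br x y"] by (simp add: l.neg algebra_simps)
next
  fix x v b1 b2 and c :: complex
  interpret l: Vector_Spaces.linear vscale vscale "br z" for z by (rule br_linear_right)
  interpret r: Vector_Spaces.linear vscale vscale "\<lambda>x. br x z" for z by (rule br_linear_left)
  show "br (b1 + b2) v = br b1 v + br b2 v" by (rule r.add)
  show "br (vscale c b1) v = vscale c (br b1 v)" by (rule r.scale)
  show "br x (b1 + b2) = br x b1 + br x b2" by (rule l.add)
  show "br x (vscale c b1) = vscale c (br x b1)" by (rule l.scale)
qed


section \<open>Second Chevalley--Eilenberg cohomology\<close>

definition CE_C1 ::
  "(complex \<Rightarrow> 'g::ab_group_add \<Rightarrow> 'g) \<Rightarrow> (complex \<Rightarrow> 'v::ab_group_add \<Rightarrow> 'v) \<Rightarrow> ('g \<Rightarrow> 'v) set" where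
  "CE_C1 gscale vscale = {f. Vector_Spaces.linear gscale vscale f}"

definition CE_C2 ::
  "(complex \<Rightarrow> 'g::ab_group_add \<Rightarrow> 'g) \<Rightarrow> (complex \<Rightarrow> 'v::ab_group_add \<Rightarrow> 'v) \<Rightarrow>
    ('g \<Rightarrow> 'g \<Rightarrow> 'v) set" where
  "CE_C2 gscale vscale =
    {f. (\<forall>x. Vector_Spaces.linear gscale vscale (f x)) \<and>
        (\<forall>y. Vector_Spaces.linear gscale vscale (\<lambda>x. f x y)) \<and> (\<forall>x. f x x = 0)}"

definition CE_d1 ::
  "('g \<Rightarrow> 'g \<Rightarrow> 'g) \<Rightarrow> ('g \<Rightarrow> 'v::ab_group_add \<Rightarrow> 'v) \<Rightarrow> ('g \<Rightarrow> 'v) \<Rightarrow> 'g \<Rightarrow> 'g \<Rightarrow> 'v" where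
  "CE_d1 br act f = (\<lambda>x y. act x (f y) - act y (f x) - f (br x y))"

definition CE_d2 ::
  "('g \<Rightarrow> 'g \<Rightarrow> 'g) \<Rightarrow> ('g \<Rightarrow> 'v::ab_group_add \<Rightarrow> 'v) \<Rightarrow> ('g \<Rightarrow> 'g \<Rightarrow> 'v) \<Rightarrow>
    'g \<Rightarrow> 'g \<Rightarrow> 'g \<Rightarrow> 'v" where
  "CE_d2 br act f = (\<lambda>x y z.
      act x (f y z) - act y (f x z) + act z (f x y)
      - f (br x y) z + f (br x z) y - f (br y z) x)"

definition CE_Z2 ::
  "(complex \<Rightarrow> 'g::ab_group_add \<Rightarrow> 'g) \<Rightarrow> ('g \<Rightarrow> 'g \<Rightarrow> 'g) \<Rightarrow>
    (complex \<Rightarrow> 'v::ab_group_add \<Rightarrow> 'v) \<Rightarrow> ('g \<Rightarrow> 'v \<Rightarrow> 'v) \<Rightarrow> ('g \<Rightarrow> 'g \<Rightarrow> 'v) set" where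
  "CE_Z2 gscale br vscale act = {f \<in> CE_C2 gscale vscale. CE_d2 br act f = (\<lambda>x y z. 0)}"

definition CE_B2 ::
  "(complex \<Rightarrow> 'g::ab_group_add \<Rightarrow> 'g) \<Rightarrow> ('g \<Rightarrow> 'g \<Rightarrow> 'g) \<Rightarrow>
    (complex \<Rightarrow> 'v::ab_group_add \<Rightarrow> 'v) \<Rightarrow> ('g \<Rightarrow> 'v \<Rightarrow> 'v) \<Rightarrow> ('g \<Rightarrow> 'g \<Rightarrow> 'v) set" where
  "CE_B2 gscale br vscale act = CE_d1 br act ` CE_C1 gscale vscale"

text \<open>The quotient of the 2-cocycles by the 2-coboundaries, as a set of cosets. Its zero element is
  the coset \<^const>\<open>CE_B2\<close>, so the cohomology vanishes iff this set is the singleton of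
  \<^const>\<open>CE_B2\<close>.\<close>

definition CE_H2 ::
  "(complex \<Rightarrow> 'g::ab_group_add \<Rightarrow> 'g) \<Rightarrow> ('g \<Rightarrow> 'g \<Rightarrow> 'g) \<Rightarrow>
    (complex \<Rightarrow> 'v::ab_group_add \<Rightarrow> 'v) \<Rightarrow> ('g \<Rightarrow> 'v \<Rightarrow> 'v) \<Rightarrow> ('g \<Rightarrow> 'g \<Rightarrow> 'v) set set" where
  "CE_H2 gscale br vscale act =
    CE_Z2 gscale br vscale act //
      {(f, g). f \<in> CE_Z2 gscale br vscale act \<and> g \<in> CE_Z2 gscale br vscale act \<and>
               (\<lambda>x y. f x y - g x y) \<in> CE_B2 gscale br vscale act}"

lemma (in lie_module) CE_B2_subset_Z2: "CE_B2 gscale br vscale act \<subseteq> CE_Z2 gscale br vscale act"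
proof
  fix g assume "g \<in> CE_B2 gscale br vscale act"
  then obtain f where f: "Vector_Spaces.linear gscale vscale f" and g: "g = CE_d1 br act f"
    by (auto simp: CE_B2_def CE_C1_def)
  interpret f: Vector_Spaces.linear gscale vscale f by (rule f)
  interpret l: Vector_Spaces.linear vscale vscale "act z" for z by (rule act_linear_right)
  interpret r: Vector_Spaces.linear gscale vscale "\<lambda>x. act x v" for v by (rule act_linear_left)
  interpret bl: Vector_Spaces.linear gscale gscale "br z" for z by (rule G.br_linear_right)
  interpret br: Vector_Spaces.linear gscale gscale "\<lambda>x. br x z" for z by (rule G.br_linear_left)
  have "CE_d2 br act g x y z = 0" for x y z
  proof -
    have "br (br x y) z - br (br x z) y + br (br y z) x = 0"
      using G.jacobi[of x y z] G.br_skew[of "br x y" z] G.br_skew[of "br x z" y]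
        G.br_skew[of "br y z" x] G.br_skew[of z x] by (simp add: bl.neg algebra_simps)
    then have "f (br (br x y) z) - f (br (br x z) y) + f (br (br y z) x) = 0"
      by (metis f.add f.diff f.zero)
    then show ?thesis
      by (simp add: g CE_d1_def CE_d2_def act_br l.diff l.add algebra_simps)
  qed
  moreover have "g \<in> CE_C2 gscale vscale"
    unfolding CE_C2_def g CE_d1_def
    by (auto intro!: Vector_Spaces.linear.intro module_hom.intro module_hom_axioms.intro
        G.vector_space_axioms M.vector_space_axioms G.module_axioms M.module_axioms
        simp: f.add l.add r.add bl.add br.add f.scale l.scale r.scale bl.scale br.scale
        M.scale_right_diff_distrib G.br_self f.zero)
  ultimately show "g \<in> CE_Z2 gscale br vscale act"
    by (simp add: CE_Z2_def fun_eq_iff)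
qed


section \<open>The Lie algebra of traceless 2 by 2 matrices\<close>

typedef sl2 = "{A :: complex^2^2. trace A = 0}"
  morphisms sl2_mat Abs_sl2
  by (rule exI[of _ 0]) (simp add: trace_def)

lemma trace_sl2_mat: "trace (sl2_mat x) = 0"
  using sl2_mat[of x] by simp

instantiation sl2 :: ab_group_add
begin
definition "0 = Abs_sl2 0"
definition "x + y = Abs_sl2 (sl2_mat x + sl2_mat y)"
definition "x - y = Abs_sl2 (sl2_mat x - sl2_mat y)"
definition "- x = Abs_sl2 (- sl2_mat x)"

lemma sl2_mat_ab_group_add:
  "sl2_mat 0 = 0"
  "sl2_mat (x + y) = sl2_mat x + sl2_mat y"
  "sl2_mat (x - y) = sl2_mat x - sl2_mat y"
  "sl2_mat (- x) = - sl2_mat x"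
proof -
  have tr0: "trace (0 :: complex^2^2) = 0"
    by (simp add: trace_def)
  then have "trace (- sl2_mat x) = 0"
    using trace_sub[of 0 "sl2_mat x"] by (simp add: trace_sl2_mat)
  with tr0 show "sl2_mat 0 = 0" "sl2_mat (x + y) = sl2_mat x + sl2_mat y"
    "sl2_mat (x - y) = sl2_mat x - sl2_mat y" "sl2_mat (- x) = - sl2_mat x"
    by (simp_all add: zero_sl2_def plus_sl2_def minus_sl2_def uminus_sl2_def Abs_sl2_inverse
        trace_add trace_sub trace_sl2_mat)
qed

instance
  by standard (auto simp: sl2_mat_inject[symmetric] sl2_mat_ab_group_add)
end

definition sl2_scale :: "complex \<Rightarrow> sl2 \<Rightarrow> sl2" where
  "sl2_scale c x = Abs_sl2 (\<chi> i j. c * sl2_mat x $ i $ j)"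

definition sl2_br :: "sl2 \<Rightarrow> sl2 \<Rightarrow> sl2" where
  "sl2_br x y = Abs_sl2 (sl2_mat x ** sl2_mat y - sl2_mat y ** sl2_mat x)"

definition sl2_E :: sl2 where
  "sl2_E = Abs_sl2 (vector [vector [0, 1], vector [0, 0]])"

definition sl2_H :: sl2 where
  "sl2_H = Abs_sl2 (vector [vector [1, 0], vector [0, -1]])"

definition sl2_F :: sl2 where
  "sl2_F = Abs_sl2 (vector [vector [0, 0], vector [1, 0]])"

lemma sl2_mat_simps:
  "sl2_mat (sl2_scale c x) = (\<chi> i j. c * sl2_mat x $ i $ j)"
  "sl2_mat (sl2_br x y) = sl2_mat x ** sl2_mat y - sl2_mat y ** sl2_mat x"
  "sl2_mat sl2_E = vector [vector [0, 1], vector [0, 0]]"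
  "sl2_mat sl2_H = vector [vector [1, 0], vector [0, -1]]"
  "sl2_mat sl2_F = vector [vector [0, 0], vector [1, 0]]"
proof -
  have "trace (\<chi> i j. c * sl2_mat x $ i $ j) = c * trace (sl2_mat x)"
    by (simp add: trace_def sum_distrib_left)
  then show "sl2_mat (sl2_scale c x) = (\<chi> i j. c * sl2_mat x $ i $ j)"
    by (simp add: sl2_scale_def Abs_sl2_inverse trace_sl2_mat)
  show "sl2_mat (sl2_br x y) = sl2_mat x ** sl2_mat y - sl2_mat y ** sl2_mat x"
    using trace_mul_sym[of "sl2_mat x" "sl2_mat y"]
    by (simp add: sl2_br_def Abs_sl2_inverse trace_sub)
qed (simp_all add: sl2_E_def sl2_H_def sl2_F_def Abs_sl2_inverse trace_def sum_2)

lemma sl2_eq_iff: "x = y \<longleftrightarrow> (\<forall>i j. sl2_mat x $ i $ j = sl2_mat y $ i $ j)"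
  by (metis sl2_mat_inject vec_eq_iff)

lemma lie_algebra_sl2: "lie_algebra sl2_scale sl2_br"
proof -
  interpret vector_space sl2_scale
    by standard (auto simp: sl2_eq_iff sl2_mat_simps sl2_mat_ab_group_add algebra_simps)
  have tr: "sl2_mat x $ 2 $ 2 = - sl2_mat x $ 1 $ 1" for x
    using sl2_mat[of x] by (auto simp: trace_def sum_2 add_eq_0_iff)
  have "x \<in> span {sl2_E, sl2_H, sl2_F}" for x
  proof -
    have "x = sl2_scale (sl2_mat x $ 1 $ 2) sl2_E + sl2_scale (sl2_mat x $ 1 $ 1) sl2_H +
        sl2_scale (sl2_mat x $ 2 $ 1) sl2_F"
      by (simp add: sl2_eq_iff sl2_mat_simps sl2_mat_ab_group_add forall_2 tr)
    also have "\<dots> \<in> span {sl2_E, sl2_H, sl2_F}"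
      by (intro span_add span_scale span_base) auto
    finally show ?thesis .
  qed
  then have "finite {sl2_E, sl2_H, sl2_F} \<and> span {sl2_E, sl2_H, sl2_F} = UNIV"
    by auto
  then have fd: "\<exists>B. finite B \<and> span B = UNIV"
    by blast
  show ?thesis
  proof (unfold_locales, rule fd)
    fix x y z x' :: sl2 and c :: complex
    note sl2_simps = sl2_eq_iff sl2_mat_simps sl2_mat_ab_group_add forall_2
      matrix_matrix_mult_def sum_2
    show "sl2_br (x + x') y = sl2_br x y + sl2_br x' y"
      by (simp add: sl2_simps ring_distribs)
    show "sl2_br x (y + x') = sl2_br x y + sl2_br x x'"
      by (simp add: sl2_simps ring_distribs)
    show "sl2_br (sl2_scale c x) y = sl2_scale c (sl2_br x y)"
      by (simp add: sl2_simps ring_distribs mult_ac)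
    show "sl2_br x (sl2_scale c y) = sl2_scale c (sl2_br x y)"
      by (simp add: sl2_simps ring_distribs mult_ac)
    show "sl2_br x x = 0"
      by (simp add: sl2_simps)
    show "sl2_br x (sl2_br y z) + sl2_br y (sl2_br z x) + sl2_br z (sl2_br x y) = 0"
      by (simp add: sl2_simps tr ring_distribs mult_ac)
  qed
qed


section \<open>Modules over \<open>sl2\<close> and semidirect products\<close>

definition sl2_submodule ::
  "(complex \<Rightarrow> 'v::ab_group_add \<Rightarrow> 'v) \<Rightarrow> (sl2 \<Rightarrow> 'v \<Rightarrow> 'v) \<Rightarrow> 'v set \<Rightarrow> bool" where
  "sl2_submodule vscale act W \<longleftrightarrow> module.subspace vscale W \<and> (\<forall>g. \<forall>w\<in>W. act g w \<in> W)"

definition sl2_irreducible ::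
  "(complex \<Rightarrow> 'v::ab_group_add \<Rightarrow> 'v) \<Rightarrow> (sl2 \<Rightarrow> 'v \<Rightarrow> 'v) \<Rightarrow> 'v set \<Rightarrow> bool" where
  "sl2_irreducible vscale act W \<longleftrightarrow>
    sl2_submodule vscale act W \<and> W \<noteq> {0} \<and>
    (\<forall>U. sl2_submodule vscale act U \<and> U \<subseteq> W \<longrightarrow> U = {0} \<or> U = W)"

definition sl2_irr_hw ::
  "(complex \<Rightarrow> 'v::ab_group_add \<Rightarrow> 'v) \<Rightarrow> (sl2 \<Rightarrow> 'v \<Rightarrow> 'v) \<Rightarrow> int \<Rightarrow> 'v set \<Rightarrow> bool" where
  "sl2_irr_hw vscale act l W \<longleftrightarrow>
    sl2_irreducible vscale act W \<and>
    (\<exists>v\<in>W. v \<noteq> 0 \<and> act sl2_E v = 0 \<and> act sl2_H v = vscale (of_int l) v)"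

definition internal_direct_sum :: "'i set \<Rightarrow> ('i \<Rightarrow> 'v::ab_group_add set) \<Rightarrow> bool" where
  "internal_direct_sum I W \<longleftrightarrow> (\<forall>x. \<exists>!u. u \<in> Pi\<^sub>E I W \<and> x = (\<Sum>i\<in>I. u i))"

text \<open>The relation \<open>[A, B] = C\<close> for submodules \<open>A, B, C\<close> of the underlying module. For
  \<open>A = B\<close> the restricted map is alternating as soon as \<open>br\<close> is part of a Lie bracket.\<close>

definition bracket_eq ::
  "(complex \<Rightarrow> 'v::ab_group_add \<Rightarrow> 'v) \<Rightarrow> (sl2 \<Rightarrow> 'v \<Rightarrow> 'v) \<Rightarrow> ('v \<Rightarrow> 'v \<Rightarrow> 'v) \<Rightarrow>
    'v set \<Rightarrow> 'v set \<Rightarrow> 'v set \<Rightarrow> bool" where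
  "bracket_eq vscale act br A B C \<longleftrightarrow>
    (\<exists>x\<in>A. \<exists>y\<in>B. br x y \<noteq> 0) \<and>
    (\<forall>g. \<forall>x\<in>A. \<forall>y\<in>B. act g (br x y) = br (act g x) y + br x (act g y)) \<and>
    module.span vscale {br x y |x y. x \<in> A \<and> y \<in> B} = C"

definition semidirect_br ::
  "('g \<Rightarrow> 'g \<Rightarrow> 'g) \<Rightarrow> ('g \<Rightarrow> 'v \<Rightarrow> 'v) \<Rightarrow> ('v \<Rightarrow> 'v \<Rightarrow> 'v::ab_group_add) \<Rightarrow>
    'g \<times> 'v \<Rightarrow> 'g \<times> 'v \<Rightarrow> 'g \<times> 'v" where
  "semidirect_br gbr act nbr = (\<lambda>(g, u) (h, w). (gbr g h, act g w - act h u + nbr u w))"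

end

theory Submission
  imports Defs "HOL-Computational_Algebra.Fundamental_Theorem_Algebra"
begin

text \<open>The cocycle is the component \<open>L\<^sub>1 \<times> L\<^sub>3 \<rightarrow> L\<^sub>n\<close> of the bracket, i.e. the derivative of the
  deformation that rescales this component alone. If it were \<open>df\<close>, Whitehead's first lemma would
  allow us to subtract an inner derivation and take \<open>f\<close> to be \<open>sl2\<close>-equivariant and zero on \<open>sl2\<close>.
  As the weights are pairwise distinct and different from 2, Schur's lemma turns \<open>f\<close> into scalars
  \<open>s\<^sub>i\<close> on the \<open>L\<^sub>i\<close>. Then \<open>2s\<^sub>1 = s\<^sub>2\<close> and \<open>s\<^sub>1 + s\<^sub>2 = 2s\<^sub>4 = s\<^sub>1 + s\<^sub>4 = s\<^sub>n\<close> force these to vanish, hence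
  also \<open>s\<^sub>3\<close> by \<open>2s\<^sub>3 = s\<^sub>n\<close>, contradicting \<open>s\<^sub>1 + s\<^sub>3 - s\<^sub>n = 1\<close>. Such an index 4 exists because \<open>n \<ge> 5\<close>.\<close>

section \<open>Eigenvectors of linear maps on invariant subspaces\<close>

definition poly_map ::
  "(complex \<Rightarrow> 'v::ab_group_add \<Rightarrow> 'v) \<Rightarrow> ('v \<Rightarrow> 'v) \<Rightarrow> complex poly \<Rightarrow> 'v \<Rightarrow> 'v" where
  "poly_map vscale T p w = (\<Sum>i\<le>degree p. vscale (coeff p i) ((T ^^ i) w))"

locale complex_vector_space = vector_space vscale
  for vscale :: "complex \<Rightarrow> 'v::ab_group_add \<Rightarrow> 'v"
begin

lemma poly_map_eq:
  assumes "degree p \<le> N"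
  shows "poly_map vscale T p w = (\<Sum>i\<le>N. vscale (coeff p i) ((T ^^ i) w))"
  unfolding poly_map_def
  by (rule sum.mono_neutral_left) (use assms in \<open>auto simp: coeff_eq_0 not_le\<close>)

text \<open>Multiplication by X - c becomes T - c: the coefficients of X q are those of
  \<open>q\<close> shifted by one, which amounts to one more application of
  \<open>T\<close>.\<close>

lemma poly_map_root_factor:
  assumes T: "Vector_Spaces.linear vscale vscale T"
  shows "poly_map vscale T ([:- c, 1:] * q) w = T (poly_map vscale T q w) - vscale c (poly_map vscale T q w)"
proof -
  interpret T: Vector_Spaces.linear vscale vscale T by (rule T)
  have "poly_map vscale T ([:- c, 1:] * q) w =
      (\<Sum>i\<le>Suc (degree q). vscale (coeff ([:- c, 1:] * q) i) ((T ^^ i) w))"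
    by (rule poly_map_eq) (use degree_mult_le[of "[:- c, 1:]" q] in auto)
  also have "\<dots> = (\<Sum>i\<le>Suc (degree q). vscale (coeff (pCons 0 q) i) ((T ^^ i) w))
      - (\<Sum>i\<le>Suc (degree q). vscale c (vscale (coeff q i) ((T ^^ i) w)))"
    unfolding sum_subtractf[symmetric]
    by (rule sum.cong) (simp_all add: scale_left_diff_distrib)
  also have "(\<Sum>i\<le>Suc (degree q). vscale (coeff (pCons 0 q) i) ((T ^^ i) w)) =
      T (poly_map vscale T q w)"
    by (subst sum.atMost_Suc_shift) (simp add: poly_map_def T.sum T.scale)
  also have "(\<Sum>i\<le>Suc (degree q). vscale c (vscale (coeff q i) ((T ^^ i) w))) =
      vscale c (poly_map vscale T q w)"
    by (simp only: scale_sum_right[symmetric] poly_map_eq[of q "Suc (degree q)", symmetric])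
  finally show ?thesis .
qed

text \<open>The powers of \<open>T\<close> up to \<open>card B\<close>, applied to \<open>w\<close>,
  are one vector more than a spanning set has, so they satisfy a linear relation. Its coefficients
  form \<open>p\<close>.\<close>

lemma poly_map_annihilator:
  assumes B: "finite B" "module.span vscale B = UNIV"
  shows "\<exists>p. p \<noteq> 0 \<and> poly_map vscale T p w = 0"
proof (cases "inj_on (\<lambda>i. (T ^^ i) w) {..card B}")
  case False
  then obtain i j where ij: "i \<noteq> j" "(T ^^ i) w = (T ^^ j) w"
    by (auto simp: inj_on_def)
  \<comment> \<open>Dependence is a notion for sets, which hides a repetition among the powers; a
    repetition gives the relation X^i - X^j directly.\<close>
  let ?p = "monom 1 i - monom 1 j :: complex poly"
  have "coeff ?p i = 1"
    using ij by (simp add: coeff_monom)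
  then have "?p \<noteq> 0"
    by force
  moreover have "degree ?p \<le> i + j"
    by (intro degree_le) (simp add: coeff_monom)
  then have "poly_map vscale T ?p w = (\<Sum>l\<le>i + j. vscale (coeff ?p l) ((T ^^ l) w))"
    by (rule poly_map_eq)
  moreover have "\<dots> = (\<Sum>l\<le>i + j. if i = l then (T ^^ l) w else 0)
      - (\<Sum>l\<le>i + j. if j = l then (T ^^ l) w else 0)"
    unfolding sum_subtractf[symmetric]
    by (rule sum.cong) (auto simp: scale_left_diff_distrib coeff_monom)
  moreover have "\<dots> = 0"
    using ij by simp
  ultimately show ?thesis
    by metis
next
  case True
  let ?S = "(\<lambda>i. (T ^^ i) w) ` {..card B}"
  have "card ?S = Suc (card B)"
    using True by (simp add: card_image)
  then have "dependent ?S"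
    using independent_span_bound[of B ?S] B by auto
  then obtain u where u: "\<exists>v\<in>?S. u v \<noteq> 0" "(\<Sum>v\<in>?S. vscale (u v) v) = 0"
    by (auto simp: dependent_finite)
  define p where "p = (\<Sum>i\<le>card B. monom (u ((T ^^ i) w)) i)"
  have co: "coeff p i = (if i \<le> card B then u ((T ^^ i) w) else 0)" for i
    by (simp add: p_def coeff_sum coeff_monom)
  obtain j where "j \<le> card B" "u ((T ^^ j) w) \<noteq> 0"
    using u(1) by auto
  then have "p \<noteq> 0"
    using co[of j] by force
  moreover have "degree p \<le> card B"
    by (intro degree_le) (simp add: co)
  then have "poly_map vscale T p w = (\<Sum>i\<le>card B. vscale (coeff p i) ((T ^^ i) w))"
    by (rule poly_map_eq)
  with u(2) have "poly_map vscale T p w = 0"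
    by (simp add: sum.reindex[OF True] co)
  ultimately show ?thesis
    by blast
qed

lemma subspace_poly_map:
  assumes "module.subspace vscale W" "T ` W \<subseteq> W" "w \<in> W"
  shows "poly_map vscale T p w \<in> W"
proof -
  have "(T ^^ i) w \<in> W" for i
    by (induction i) (use assms in auto)
  then show ?thesis
    unfolding poly_map_def using assms(1) by (auto intro!: subspace_sum subspace_scale)
qed

text \<open>Linear factors are split off a polynomial that annihilates \<open>w\<close>. The first
  time the cofactor \<open>q\<close> has q(T) w nonzero, this vector is an eigenvector, and it stays
  in the invariant subspace \<open>W\<close>.\<close>

lemma eigenvector_exists:
  assumes T: "Vector_Spaces.linear vscale vscale T"
    and W: "module.subspace vscale W" "T ` W \<subseteq> W" "W \<noteq> {0}"
    and B: "finite B" "module.span vscale B = UNIV"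
  shows "\<exists>c. \<exists>v\<in>W. v \<noteq> 0 \<and> T v = vscale c v"
proof -
  obtain w where w: "w \<in> W" "w \<noteq> 0"
    using W subspace_0 by blast
  obtain p where "p \<noteq> 0" "poly_map vscale T p w = 0"
    using poly_map_annihilator[OF B] by blast
  then show ?thesis
  proof (induction "degree p" arbitrary: p rule: less_induct)
    case less
    show ?case
    proof (cases "degree p = 0")
      case True
      then obtain a where "p = [:a:]"
        by (rule degree_eq_zeroE)
      with less.prems w show ?thesis
        by (simp add: poly_map_def)
    next
      case False
      then obtain c where "poly p c = 0"
        using fundamental_theorem_of_algebra constant_degree by metis
      then obtain q where q: "p = [:- c, 1:] * q"
        by (auto simp: poly_eq_0_iff_dvd)
      with less.prems have "q \<noteq> 0"
        by auto
      then have deg: "degree q < degree p"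
        unfolding q by (subst degree_mult_eq) auto
      have eig: "T (poly_map vscale T q w) = vscale c (poly_map vscale T q w)"
        using less.prems poly_map_root_factor[OF T, of c q w] by (simp add: q)
      show ?thesis
      proof (cases "poly_map vscale T q w = 0")
        case True
        then show ?thesis
          using less.hyps deg \<open>q \<noteq> 0\<close> by blast
      next
        case False
        then show ?thesis
          using eig subspace_poly_map[OF W(1,2) w(1)] by blast
      qed
    qed
  qed
qed

end

section \<open>The Casimir operator\<close>

lemma sl2_trace: "sl2_mat x $ 2 $ 2 = - sl2_mat x $ 1 $ 1"
  using trace_sl2_mat[of x] by (auto simp: trace_def sum_2 add_eq_0_iff)

lemma sl2_decomp:
  "x = sl2_scale (sl2_mat x $ 1 $ 2) sl2_E + sl2_scale (sl2_mat x $ 1 $ 1) sl2_H +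
        sl2_scale (sl2_mat x $ 2 $ 1) sl2_F"
  by (simp add: sl2_eq_iff sl2_mat_simps sl2_mat_ab_group_add forall_2 sl2_trace)

lemma sl2_br_EHF:
  "sl2_br sl2_E sl2_F = sl2_H"
  "sl2_br sl2_H sl2_E = sl2_E + sl2_E"
  "sl2_br sl2_H sl2_F = - sl2_F - sl2_F"
  by (simp_all add: sl2_eq_iff sl2_mat_simps sl2_mat_ab_group_add forall_2
      matrix_matrix_mult_def sum_2)

locale sl2_module = lie_module sl2_scale sl2_br vscale act
  for vscale :: "complex \<Rightarrow> 'v::ab_group_add \<Rightarrow> 'v" and act :: "sl2 \<Rightarrow> 'v \<Rightarrow> 'v"
begin

sublocale complex_vector_space vscale ..

lemma act_right:
  "act g (x + y) = act g x + act g y" "act g (x - y) = act g x - act g y" "act g (- x) = - act g x"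
  "act g 0 = 0" "act g (vscale c x) = vscale c (act g x)" "act g (sum f S) = (\<Sum>i\<in>S. act g (f i))"
proof -
  interpret l: Vector_Spaces.linear vscale vscale "act g" by (rule act_linear_right)
  show "act g (x + y) = act g x + act g y" "act g (x - y) = act g x - act g y"
    "act g (- x) = - act g x" "act g 0 = 0" "act g (vscale c x) = vscale c (act g x)"
    "act g (sum f S) = (\<Sum>i\<in>S. act g (f i))"
    by (rule l.add l.diff l.neg l.zero l.scale l.sum)+
qed

lemma act_left:
  "act (g + h) x = act g x + act h x" "act (g - h) x = act g x - act h x" "act (- g) x = - act g x"
  "act 0 x = 0" "act (sl2_scale c g) x = vscale c (act g x)"
proof -
  interpret l: Vector_Spaces.linear sl2_scale vscale "\<lambda>g. act g x" by (rule act_linear_left)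
  show "act (g + h) x = act g x + act h x" "act (g - h) x = act g x - act h x"
    "act (- g) x = - act g x" "act 0 x = 0" "act (sl2_scale c g) x = vscale c (act g x)"
    by (rule l.add l.diff l.neg l.zero l.scale)+
qed

lemma act_comm:
  "act sl2_E (act sl2_F x) = act sl2_F (act sl2_E x) + act sl2_H x"
  "act sl2_H (act sl2_E x) = act sl2_E (act sl2_H x) + act sl2_E x + act sl2_E x"
  "act sl2_H (act sl2_F x) = act sl2_F (act sl2_H x) - act sl2_F x - act sl2_F x"
  using act_br[of sl2_E sl2_F x] act_br[of sl2_H sl2_E x] act_br[of sl2_H sl2_F x]
  unfolding sl2_br_EHF by (simp_all add: act_left algebra_simps)

text \<open>The opposite orientation of \<open>act_comm\<close>. As rewrite rules,
  \<open>act_comm\<close> sorts words into the order F, E, H from the outside in, this lemma into H,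
  E, F.\<close>

lemma act_comm':
  "act sl2_F (act sl2_E x) = act sl2_E (act sl2_F x) - act sl2_H x"
  "act sl2_E (act sl2_H x) = act sl2_H (act sl2_E x) - act sl2_E x - act sl2_E x"
  "act sl2_F (act sl2_H x) = act sl2_H (act sl2_F x) + act sl2_F x + act sl2_F x"
  by (simp_all add: act_comm)

text \<open>This is H^2 + 2EF + 2FE, twice the Casimir element of the trace form; the scaling gives
  the eigenvalue l(l + 2) on V_l. Doubling is written as repetition to keep scalars out of the
  rewriting.\<close>

definition casimir :: "'v \<Rightarrow> 'v" where
  "casimir x = act sl2_H (act sl2_H x) + act sl2_E (act sl2_F x) + act sl2_E (act sl2_F x)
     + act sl2_F (act sl2_E x) + act sl2_F (act sl2_E x)"

lemma casimir_linear: "Vector_Spaces.linear vscale vscale casimir"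
  by unfold_locales (simp_all add: casimir_def act_right M.scale_right_distrib algebra_simps)

lemma equivariant_EHF:
  assumes T: "Vector_Spaces.linear vscale vscale T"
    and EHF: "\<And>g x. g \<in> {sl2_E, sl2_H, sl2_F} \<Longrightarrow> T (act g x) = act g (T x)"
  shows "T (act g x) = act g (T x)"
proof -
  interpret T: Vector_Spaces.linear vscale vscale T by (rule T)
  show ?thesis
    by (subst (1 2) sl2_decomp[of g]) (simp add: act_left T.add T.scale EHF)
qed

text \<open>Centrality of the Casimir element, checked on E, H, F by sorting both sides with
  \<open>act_comm\<close>.\<close>

lemma casimir_act: "casimir (act g x) = act g (casimir x)"
  by (rule equivariant_EHF[OF casimir_linear])
    (auto simp: casimir_def act_comm act_right algebra_simps)

text \<open>Since EF = FE + H, a vector killed by E sees only H^2 + 2H, hence l(l + 2). By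
  centrality the eigenspace in \<open>W\<close> is a submodule, so irreducibility spreads the
  eigenvalue to all of \<open>W\<close>.\<close>

lemma casimir_irr_hw:
  assumes "sl2_irr_hw vscale act l W" "x \<in> W"
  shows "casimir x = vscale (of_int (l * (l + 2))) x"
proof -
  interpret C: Vector_Spaces.linear vscale vscale casimir by (rule casimir_linear)
  let ?c = "of_int (l * (l + 2)) :: complex"
  let ?U = "{x \<in> W. casimir x = vscale ?c x}"
  obtain v where v: "v \<in> W" "v \<noteq> 0" "act sl2_E v = 0" "act sl2_H v = vscale (of_int l) v"
    and W: "sl2_irreducible vscale act W"
    using assms by (auto simp: sl2_irr_hw_def)
  have subW: "module.subspace vscale W" and actW: "\<And>g w. w \<in> W \<Longrightarrow> act g w \<in> W"
    using W by (auto simp: sl2_irreducible_def sl2_submodule_def)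
  have c: "?c = of_int l * of_int l + of_int l + of_int l"
    by (simp add: algebra_simps)
  have "casimir v = act sl2_H (act sl2_H v) + act sl2_H v + act sl2_H v"
    using v(3) by (simp add: casimir_def act_comm act_right)
  then have "casimir v = vscale ?c v"
    unfolding c by (simp only: v(4) act_right M.scale_left_distrib M.scale_scale)
  with v have "v \<in> ?U"
    by simp
  moreover have "sl2_submodule vscale act ?U"
    unfolding sl2_submodule_def
    by (auto intro!: M.subspaceI actW M.subspace_0[OF subW] M.subspace_add[OF subW]
        M.subspace_scale[OF subW]
        simp: C.add C.scale casimir_act act_right M.scale_right_distrib M.scale_left_commute)
  ultimately have "?U = W"
    using W v(2) unfolding sl2_irreducible_def by blast
  then show ?thesis
    using assms by blast
qed

text \<open>Whitehead's first lemma. If \<open>\<Sum> a\<^sub>i b\<^sub>i\<close> is the Casimir element then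
  \<open>w = \<Sum> a\<^sub>i \<delta>(b\<^sub>i)\<close> satisfies \<open>g w = casimir (\<delta> g)\<close>.\<close>

lemma derivation_inner:
  assumes d: "Vector_Spaces.linear sl2_scale vscale d"
    and der: "\<And>g h. d (sl2_br g h) = act g (d h) - act h (d g)"
    and Q: "Vector_Spaces.linear vscale vscale Q" "\<And>g x. Q (act g x) = act g (Q x)"
      "\<And>x. Q (casimir x) = x"
  shows "\<exists>u. \<forall>g. d g = act g u"
proof (intro exI allI)
  interpret d: Vector_Spaces.linear sl2_scale vscale d by (rule d)
  interpret C: Vector_Spaces.linear vscale vscale casimir by (rule casimir_linear)
  let ?E = sl2_E and ?F = sl2_F and ?H = sl2_H
  let ?w = "act ?H (d ?H) + act ?E (d ?F) + act ?E (d ?F) + act ?F (d ?E) + act ?F (d ?E)"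
  have FE: "act ?F (d ?E) = act ?E (d ?F) - d ?H"
    and EH: "act ?E (d ?H) = act ?H (d ?E) - d ?E - d ?E"
    and FH: "act ?F (d ?H) = act ?H (d ?F) + d ?F + d ?F"
    using der[of ?E ?F] der[of ?H ?E] der[of ?H ?F]
    by (simp_all add: sl2_br_EHF d.add d.diff d.neg algebra_simps)
  have "casimir (d ?E) = act ?E ?w" "casimir (d ?H) = act ?H ?w" "casimir (d ?F) = act ?F ?w"
    by (simp_all add: casimir_def act_right act_comm' FE EH FH algebra_simps)
  then have "casimir (d g) = act g ?w" for g
    by (subst (1 2) sl2_decomp[of g]) (simp only: d.add d.scale act_left C.add C.scale)
  then show "d g = act g (Q ?w)" for g
    using Q by metis
qed

text \<open>An eigenvalue exists on \<open>W\<close>, and its eigenspace there is a nonzero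
  submodule, hence \<open>W\<close>. Modules are sets here and not types, so \<open>T\<close> is a
  map of the whole space that preserves \<open>W\<close>.\<close>

lemma schur:
  assumes B: "finite B" "module.span vscale B = UNIV"
    and W: "sl2_irreducible vscale act W"
    and T: "Vector_Spaces.linear vscale vscale T" "T ` W \<subseteq> W"
      "\<And>g x. x \<in> W \<Longrightarrow> T (act g x) = act g (T x)"
  shows "\<exists>c. \<forall>x\<in>W. T x = vscale c x"
proof -
  interpret T: Vector_Spaces.linear vscale vscale T by (rule T)
  have subW: "module.subspace vscale W" and actW: "\<And>g w. w \<in> W \<Longrightarrow> act g w \<in> W"
    and "W \<noteq> {0}"
    using W by (auto simp: sl2_irreducible_def sl2_submodule_def)
  then obtain c v where v: "v \<in> W" "v \<noteq> 0" "T v = vscale c v"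
    using eigenvector_exists[OF T(1) _ T(2) _ B] by blast
  let ?U = "{x \<in> W. T x = vscale c x}"
  have "sl2_submodule vscale act ?U"
    unfolding sl2_submodule_def
    by (auto intro!: M.subspaceI actW M.subspace_0[OF subW] M.subspace_add[OF subW]
        M.subspace_scale[OF subW]
        simp: T.add T.scale T(3) act_right M.scale_right_distrib M.scale_left_commute)
  with v have "?U = W"
    using W unfolding sl2_irreducible_def by blast
  then show ?thesis
    by blast
qed

end

interpretation adj: sl2_module sl2_scale sl2_br
  by (intro sl2_module.intro lie_algebra.adjoint_module lie_algebra_sl2)

text \<open>The adjoint module is V_2, and 8 = 2(2 + 2).\<close>

lemma casimir_adjoint: "adj.casimir x = sl2_scale 8 x"
  unfolding adj.casimir_def
  by (simp add: sl2_eq_iff sl2_mat_simps sl2_mat_ab_group_add forall_2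
      matrix_matrix_mult_def sum_2 sl2_trace)

lemma adjoint_derivation_inner:
  assumes "Vector_Spaces.linear sl2_scale sl2_scale d"
    and "\<And>g h. d (sl2_br g h) = sl2_br g (d h) - sl2_br h (d g)"
  shows "\<exists>u. \<forall>g. d g = sl2_br g u"
proof (rule adj.derivation_inner[OF assms])
  show "Vector_Spaces.linear sl2_scale sl2_scale (sl2_scale (1 / 8))"
    by (rule adj.G.linear_scale_self)
qed (simp_all add: adj.act_right casimir_adjoint)

section \<open>Decomposition into irreducible modules\<close>

locale decomposed_sl2_module = sl2_module vscale act
  for vscale :: "complex \<Rightarrow> 'v::ab_group_add \<Rightarrow> 'v" and act :: "sl2 \<Rightarrow> 'v \<Rightarrow> 'v" +
  fixes I :: "'i set" and V :: "'i \<Rightarrow> 'v set" and lam :: "'i \<Rightarrow> int"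
  assumes finite_I: "finite I"
    and direct_sum: "internal_direct_sum I V"
    and irr: "\<And>i. i \<in> I \<Longrightarrow> sl2_irr_hw vscale act (lam i) (V i)"
begin

lemma irreducible_V: "i \<in> I \<Longrightarrow> sl2_irreducible vscale act (V i)"
  using irr by (auto simp: sl2_irr_hw_def)

lemma subspace_V: "i \<in> I \<Longrightarrow> module.subspace vscale (V i)"
  and act_V: "i \<in> I \<Longrightarrow> x \<in> V i \<Longrightarrow> act g x \<in> V i"
  using irreducible_V by (auto simp: sl2_irreducible_def sl2_submodule_def)

text \<open>The family is unique only among those that are \<open>undefined\<close> outside
  \<open>I\<close>, so the component has meaning for \<open>i\<close> in \<open>I\<close>
  alone.\<close>

definition proj :: "'i \<Rightarrow> 'v \<Rightarrow> 'v" where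
  "proj i x = (THE u. u \<in> Pi\<^sub>E I V \<and> x = (\<Sum>i\<in>I. u i)) i"

lemma proj_in: "i \<in> I \<Longrightarrow> proj i x \<in> V i"
  and proj_sum: "(\<Sum>i\<in>I. proj i x) = x"
proof -
  have "\<exists>!u. u \<in> Pi\<^sub>E I V \<and> x = (\<Sum>i\<in>I. u i)"
    using direct_sum by (simp add: internal_direct_sum_def)
  from theI'[OF this] show "i \<in> I \<Longrightarrow> proj i x \<in> V i" "(\<Sum>i\<in>I. proj i x) = x"
    by (auto simp: proj_def)
qed

lemma proj_unique:
  assumes "\<And>i. i \<in> I \<Longrightarrow> u i \<in> V i" "x = (\<Sum>i\<in>I. u i)" "i \<in> I"
  shows "proj i x = u i"
proof -
  have "(THE u. u \<in> Pi\<^sub>E I V \<and> x = (\<Sum>i\<in>I. u i)) = restrict u I"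
    by (rule the1_equality) (use direct_sum assms in \<open>auto simp: internal_direct_sum_def\<close>)
  with assms(3) show ?thesis
    by (simp add: proj_def)
qed

text \<open>Applying \<open>T\<close> to the decomposition of \<open>x\<close> decomposes
  \<open>T x\<close>. The instances are the action, scaling and the Casimir operator.\<close>

lemma proj_commute:
  assumes T: "Vector_Spaces.linear vscale vscale T" "\<And>i x. i \<in> I \<Longrightarrow> x \<in> V i \<Longrightarrow> T x \<in> V i"
    and "i \<in> I"
  shows "proj i (T x) = T (proj i x)"
proof (rule proj_unique[OF _ _ \<open>i \<in> I\<close>])
  interpret T: Vector_Spaces.linear vscale vscale T by (rule T)
  show "T x = (\<Sum>i\<in>I. T (proj i x))"
    by (simp add: T.sum[symmetric] proj_sum)
qed (simp add: T proj_in)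

lemma proj_act: "i \<in> I \<Longrightarrow> proj i (act g x) = act g (proj i x)"
  by (rule proj_commute) (auto simp: act_linear_right act_V)

lemma proj_add: "i \<in> I \<Longrightarrow> proj i (x + y) = proj i x + proj i y"
  by (rule proj_unique)
    (auto simp: proj_in proj_sum sum.distrib intro!: M.subspace_add subspace_V)

lemma proj_scale: "i \<in> I \<Longrightarrow> proj i (vscale c x) = vscale c (proj i x)"
  by (rule proj_commute)
    (auto simp: M.linear_scale_self intro!: M.subspace_scale subspace_V)

lemma proj_linear: "i \<in> I \<Longrightarrow> Vector_Spaces.linear vscale vscale (proj i)"
  by unfold_locales (simp_all add: proj_add proj_scale)

lemma proj_V:
  assumes "i \<in> I" "j \<in> I" "x \<in> V j"
  shows "proj i x = (if i = j then x else 0)"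
  by (rule proj_unique[OF _ _ assms(1)])
    (use assms finite_I in \<open>auto intro!: M.subspace_0 subspace_V\<close>)

lemma proj_zero: "i \<in> I \<Longrightarrow> proj i 0 = 0"
  using proj_V[of i i 0] M.subspace_0[OF subspace_V] by simp

lemma casimir_V: "i \<in> I \<Longrightarrow> x \<in> V i \<Longrightarrow> casimir x = vscale (of_int (lam i * (lam i + 2))) x"
  using casimir_irr_hw irr by blast

text \<open>On nonnegative weights l(l + 2) is injective, and the weights are pairwise distinct, so
  the Casimir eigenvalue singles out one summand: all other components of \<open>x\<close>
  vanish.\<close>

lemma casimir_eigenspace:
  assumes lam: "\<And>j. j \<in> I \<Longrightarrow> lam j \<ge> 0" "inj_on lam I"
    and i: "i \<in> I" and x: "casimir x = vscale (of_int (lam i * (lam i + 2))) x"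
  shows "x \<in> V i"
proof -
  have "proj j x = 0" if j: "j \<in> I" "j \<noteq> i" for j
  proof -
    have "proj j (casimir x) = casimir (proj j x)"
      by (rule proj_commute)
        (auto simp: casimir_linear casimir_V j intro!: M.subspace_scale subspace_V)
    then have "vscale (of_int (lam i * (lam i + 2))) (proj j x)
        = vscale (of_int (lam j * (lam j + 2))) (proj j x)"
      by (simp only: x proj_scale[OF j(1)] casimir_V[OF j(1) proj_in[OF j(1)]])
    moreover have "lam i * (lam i + 2) \<noteq> lam j * (lam j + 2)"
    proof
      assume "lam i * (lam i + 2) = lam j * (lam j + 2)"
      then have "(lam j - lam i) * (lam j + lam i + 2) = 0"
        by (simp add: algebra_simps)
      then show False
        using j i lam(1)[of i] lam(1)[of j] lam(2) by (auto simp: inj_on_def)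
    qed
    ultimately show ?thesis
      by (simp only: M.scale_cancel_right of_int_eq_iff) simp
  qed
  then have "x = proj i x"
    using proj_sum[of x] i finite_I by (simp add: sum.remove)
  then show ?thesis
    using proj_in[OF i] by metis
qed

text \<open>\<open>T\<close> commutes with the Casimir operator, whose eigenspaces are the
  \<open>V i\<close> because the weights are distinct; so each \<open>V i\<close> is preserved and
  \<open>schur\<close> applies.\<close>

lemma equivariant_scalars:
  assumes lam: "\<And>j. j \<in> I \<Longrightarrow> lam j \<ge> 0" "inj_on lam I"
    and B: "finite B" "module.span vscale B = UNIV"
    and T: "Vector_Spaces.linear vscale vscale T" "\<And>g x. T (act g x) = act g (T x)"
  shows "\<exists>s. \<forall>i\<in>I. \<forall>x\<in>V i. T x = vscale (s i) x"
proof -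
  interpret T: Vector_Spaces.linear vscale vscale T by (rule T)
  have "casimir (T x) = T (casimir x)" for x
    by (simp add: casimir_def T T.add)
  then have "T ` V i \<subseteq> V i" if "i \<in> I" for i
    using casimir_eigenspace[OF lam that] casimir_V[OF that] by (auto simp: T.scale)
  then have "\<forall>i\<in>I. \<exists>c. \<forall>x\<in>V i. T x = vscale c x"
    using schur[OF B irreducible_V T(1)] T(2) by blast
  then show ?thesis
    by (rule bchoice)
qed

text \<open>Positive weights make every Casimir eigenvalue nonzero, so dividing each component by it
  inverts the Casimir operator. This inverse is the \<open>Q\<close> of
  \<open>derivation_inner\<close>.\<close>

lemma derivation_inner_pos:
  assumes lam: "\<And>j. j \<in> I \<Longrightarrow> lam j > 0"
    and d: "Vector_Spaces.linear sl2_scale vscale d"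
      "\<And>g h. d (sl2_br g h) = act g (d h) - act h (d g)"
  shows "\<exists>u. \<forall>g. d g = act g u"
proof (rule derivation_inner[OF d])
  let ?Q = "\<lambda>x. \<Sum>i\<in>I. vscale (1 / of_int (lam i * (lam i + 2))) (proj i x)"
  show "Vector_Spaces.linear vscale vscale ?Q"
    by unfold_locales
      (auto simp: proj_add proj_scale M.scale_right_distrib sum.distrib M.scale_sum_right mult.commute
        intro!: sum.cong)
  show "?Q (act g x) = act g (?Q x)" for g x
    by (simp add: act_right proj_act)
  show "?Q (casimir x) = x" for x
  proof -
    have "vscale (1 / of_int (lam i * (lam i + 2))) (proj i (casimir x)) = proj i x"
      if i: "i \<in> I" for i
    proof -
      have "proj i (casimir x) = casimir (proj i x)"
        by (rule proj_commute)
          (auto simp: casimir_linear casimir_V i intro!: M.subspace_scale subspace_V)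
      moreover have "(of_int (lam i * (lam i + 2)) :: complex) \<noteq> 0"
        unfolding of_int_eq_0_iff using lam[OF i] by auto
      ultimately show ?thesis
        by (simp add: casimir_V[OF i proj_in[OF i]] del: of_int_mult)
    qed
    then show ?thesis
      by (simp add: proj_sum)
  qed
qed

end

section \<open>Cochains of a semidirect product\<close>

abbreviation (input) semidirect_scale ::
  "(complex \<Rightarrow> 'v::ab_group_add \<Rightarrow> 'v) \<Rightarrow> complex \<Rightarrow> sl2 \<times> 'v \<Rightarrow> sl2 \<times> 'v" where
  "semidirect_scale vscale \<equiv> module_prod.scale sl2_scale vscale"

text \<open>The Lie axioms are stated for the semidirect product only; bilinearity, skew symmetry
  and the Jacobi identity of \<open>br\<close> are read off from the pairs
  \<open>(0, x)\<close>.\<close>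

locale sl2_semidirect = sl2_module vscale act
  for vscale :: "complex \<Rightarrow> 'v::ab_group_add \<Rightarrow> 'v" and act :: "sl2 \<Rightarrow> 'v \<Rightarrow> 'v" +
  fixes br :: "'v \<Rightarrow> 'v \<Rightarrow> 'v"
  assumes lie_semidirect: "lie_algebra (semidirect_scale vscale) (semidirect_br sl2_br act br)"
begin

abbreviation (input) "scaleL \<equiv> semidirect_scale vscale"
abbreviation (input) "brL \<equiv> semidirect_br sl2_br act br"

interpretation L: lie_algebra scaleL brL by (rule lie_semidirect)

lemma module_prod: "module_prod sl2_scale vscale" ..

lemma scaleL_pair: "scaleL c (g, x) = (sl2_scale c g, vscale c x)"
  by (simp add: module_prod.scale_def[OF module_prod])

lemma brL_pair: "brL (g, x) (h, y) = (sl2_br g h, act g y - act h x + br x y)"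
  by (simp add: semidirect_br_def)

lemma br_linear:
  "br (x + x') y = br x y + br x' y" "br x (y + y') = br x y + br x y'"
  "br (vscale c x) y = vscale c (br x y)" "br x (vscale c y) = vscale c (br x y)"
proof -
  interpret l: Vector_Spaces.linear scaleL scaleL "brL (0, x)" for x by (rule L.br_linear_right)
  interpret r: Vector_Spaces.linear scaleL scaleL "\<lambda>u. brL u (0, y)" for y
    by (rule L.br_linear_left)
  show "br (x + x') y = br x y + br x' y" "br x (y + y') = br x y + br x y'"
    using r.add[of "(0, x)" "(0, x')" y] l.add[of x "(0, y)" "(0, y')"]
    by (simp_all add: brL_pair act_left)
  show "br (vscale c x) y = vscale c (br x y)" "br x (vscale c y) = vscale c (br x y)"
    using r.scale[of c "(0, x)" y] l.scale[of x c "(0, y)"]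
    by (simp_all add: brL_pair scaleL_pair act_left)
qed

lemma br_linear_right_map: "Vector_Spaces.linear vscale vscale (br x)"
  and br_linear_left_map: "Vector_Spaces.linear vscale vscale (\<lambda>x. br x y)"
  by (unfold_locales; simp add: br_linear)+

lemma br_zero: "br 0 y = 0" "br x 0 = 0"
  using br_linear(1)[of 0 0] br_linear(2)[of _ 0 0] by simp_all

lemma br_skew: "br y x = - br x y"
  using L.br_skew[of "(0, y)" "(0, x)"] by (simp add: brL_pair act_left)

lemma br_minus: "br (- x) y = - br x y" "br x (- y) = - br x y"
  using br_linear(1)[of x "- x" y] br_linear(2)[of x y "- y"]
  by (simp_all add: br_zero eq_neg_iff_add_eq_0 add.commute)

lemma br_diff: "br (x - x') y = br x y - br x' y" "br x (y - y') = br x y - br x y'"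
  using br_linear(1)[of x "- x'" y] br_linear(2)[of x y "- y'"] by (simp_all add: br_minus)

lemma br_sum: "br (\<Sum>i\<in>S. f i) y = (\<Sum>i\<in>S. br (f i) y)" "br x (\<Sum>i\<in>S. h i) = (\<Sum>i\<in>S. br x (h i))"
proof -
  interpret l: Vector_Spaces.linear vscale vscale "br x" by (rule br_linear_right_map)
  interpret r: Vector_Spaces.linear vscale vscale "\<lambda>x. br x y" by (rule br_linear_left_map)
  show "br (\<Sum>i\<in>S. f i) y = (\<Sum>i\<in>S. br (f i) y)" "br x (\<Sum>i\<in>S. h i) = (\<Sum>i\<in>S. br x (h i))"
    by (rule r.sum l.sum)+
qed

text \<open>The Jacobi identity at one element of \<open>sl2\<close> and two of the module.\<close>

lemma act_br_derivation: "act g (br x y) = br (act g x) y + br x (act g y)"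
  using L.jacobi[of "(g, 0)" "(0, x)" "(0, y)"] br_skew[of y "act g x"]
  by (simp add: brL_pair br_zero br_minus act_left act_right adj.act_left adj.act_right
        zero_prod_def algebra_simps)

text \<open>The Jacobi identity inside the module, in the form that makes bracketing with
  \<open>u\<close> from the right a derivation; it later cancels an inner correction.\<close>

lemma br_inner_derivation: "br (br x y) u = br (br x u) y + br x (br y u)"
  using L.jacobi[of "(0, x)" "(0, y)" "(0, u)"] br_skew[of u x] br_skew[of "br x y" u]
    br_skew[of "br x u" y]
  by (simp add: brL_pair br_zero br_minus act_left act_right adj.act_left adj.act_right
        zero_prod_def algebra_simps)

lemma finite_dim_V: "\<exists>B. finite B \<and> module.span vscale B = UNIV"
proof -
  obtain B where B: "finite B" "module.span scaleL B = UNIV"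
    using L.finite_dim by blast
  have lin: "Vector_Spaces.linear scaleL vscale snd"
    by unfold_locales (auto simp: scaleL_pair)
  have "module.span vscale (snd ` B) = snd ` module.span scaleL B"
    using module_hom.span_image lin module_hom_iff_linear by metis
  then show ?thesis
    using B by (intro exI[of _ "snd ` B"]) simp
qed

text \<open>In the cocycle identity the terms that combine \<phi> with \<open>br\<close> vanish,
  because \<open>br\<close> kills the values of \<phi> and \<phi> kills brackets. In each remaining
  term one element of \<open>sl2\<close> acts, and these cancel by equivariance.\<close>

lemma cocycle_extension:
  assumes lin: "\<And>x. Vector_Spaces.linear vscale vscale (\<phi> x)"
      "\<And>y. Vector_Spaces.linear vscale vscale (\<lambda>x. \<phi> x y)"
    and alt: "\<And>x. \<phi> x x = 0"
    and equiv: "\<And>g x y. act g (\<phi> x y) = \<phi> (act g x) y + \<phi> x (act g y)"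
    and br: "\<And>x y z. br x (\<phi> y z) = 0" "\<And>x y z. \<phi> (br x y) z = 0"
  shows "(\<lambda>(g, x) (h, y). (0, \<phi> x y)) \<in> CE_Z2 scaleL brL scaleL brL"
proof -
  interpret l: Vector_Spaces.linear vscale vscale "\<phi> x" for x by (rule lin)
  interpret r: Vector_Spaces.linear vscale vscale "\<lambda>x. \<phi> x y" for y by (rule lin)
  let ?f = "\<lambda>(g :: sl2, x) (h :: sl2, y). (0 :: sl2, \<phi> x y)"
  have "\<phi> (x + y) (x + y) = (\<phi> x x + \<phi> y x) + (\<phi> x y + \<phi> y y)" for x y
    by (simp only: l.add r.add)
  then have skew: "\<phi> y x = - \<phi> x y" for x y
    by (simp add: alt eq_neg_iff_add_eq_0)
  have "?f \<in> CE_C2 scaleL scaleL"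
    unfolding CE_C2_def
  proof (intro CollectI conjI allI)
    show "Vector_Spaces.linear scaleL scaleL (?f u)" for u
      by unfold_locales (auto simp: scaleL_pair l.add l.scale split: prod.splits)
    show "Vector_Spaces.linear scaleL scaleL (\<lambda>u. ?f u v)" for v
      by unfold_locales (auto simp: scaleL_pair r.add r.scale split: prod.splits)
    show "?f u u = 0" for u
      by (auto simp: alt zero_prod_def split: prod.splits)
  qed
  moreover have "CE_d2 brL brL ?f (g, x) (h, y) (k, z) = 0" for g x h y k z
    using skew[of "act h z" x] skew[of "act g z" y] skew[of "act g y" z]
      skew[of "act h x" z] skew[of "act k x" y] skew[of "act k y" x]
    by (simp add: CE_d2_def brL_pair equiv br act_left l.add r.add l.diff r.diff
        adj.act_left adj.act_right zero_prod_def)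
  ultimately show ?thesis
    by (auto simp: CE_Z2_def fun_eq_iff)
qed

end

section \<open>Coboundaries expressed by scalars on the summands\<close>

locale decomposed_sl2_semidirect =
  sl2_semidirect vscale act br + decomposed_sl2_module vscale act I V lam
  for vscale :: "complex \<Rightarrow> 'v::ab_group_add \<Rightarrow> 'v" and act :: "sl2 \<Rightarrow> 'v \<Rightarrow> 'v"
    and br :: "'v \<Rightarrow> 'v \<Rightarrow> 'v"
    and I :: "'i set" and V :: "'i \<Rightarrow> 'v set" and lam :: "'i \<Rightarrow> int"
begin

text \<open>The weight 2 is excluded since \<^typ>\<open>sl2\<close> itself has it.\<close>

lemma coboundary_scalars:
  assumes lam: "\<And>j. j \<in> I \<Longrightarrow> lam j > 0" "\<And>j. j \<in> I \<Longrightarrow> lam j \<noteq> 2" "inj_on lam I"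
    and \<phi>: "\<And>x. \<phi> x 0 = 0" "\<And>y. \<phi> 0 y = 0"
    and cob: "(\<lambda>(g, x) (h, y). (0, \<phi> x y)) \<in> CE_B2 scaleL brL scaleL brL"
  shows "\<exists>s. \<forall>i\<in>I. \<forall>j\<in>I. \<forall>k\<in>I. \<forall>x\<in>V i. \<forall>y\<in>V j. br x y \<in> V k \<longrightarrow>
      \<phi> x y = vscale (s i + s j - s k) (br x y)"
proof -
  obtain f where f: "Vector_Spaces.linear scaleL scaleL f"
    and df: "CE_d1 brL brL f = (\<lambda>(g, x) (h, y). (0, \<phi> x y))"
    using cob by (auto simp: CE_B2_def CE_C1_def)
  interpret f: Vector_Spaces.linear scaleL scaleL f by (rule f)
  have df: "brL (g, x) (f (h, y)) - brL (h, y) (f (g, x)) - f (brL (g, x) (h, y)) = (0, \<phi> x y)"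
    for g x h y
    using fun_cong[OF fun_cong[OF df], of "(g, x)" "(h, y)"] by (simp add: CE_d1_def)
  \<comment> \<open>The four blocks of \<open>f\<close>: \<open>a\<close> and \<open>t\<close> on
    the module, \<open>b\<close> and \<open>d\<close> on \<open>sl2\<close>, each pair being the
    \<open>sl2\<close> and the module component.\<close>
  define a t where "a = (\<lambda>w. fst (f (0, w)))" and "t = (\<lambda>w. snd (f (0, w)))"
  define b d where "b = (\<lambda>g. fst (f (g, 0)))" and "d = (\<lambda>g. snd (f (g, 0)))"
  have f0: "f (0, w) = (a w, t w)" "f (g, 0) = (b g, d g)" for g w
    by (simp_all add: a_def t_def b_def d_def)
  have f_add: "f (0, x + y) = f (0, x) + f (0, y)" "f (g + h, 0) = f (g, 0) + f (h, 0)" for x y g h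
    using f.add[of "(0, x)" "(0, y)"] f.add[of "(g, 0)" "(h, 0)"] by simp_all
  have f_scale: "f (0, vscale c x) = scaleL c (f (0, x))"
    "f (sl2_scale c g, 0) = scaleL c (f (g, 0))" for c x g
    using f.scale[of c "(0, x)"] f.scale[of c "(g, 0)"] by (simp_all add: scaleL_pair)
  have lin: "Vector_Spaces.linear vscale sl2_scale a" "Vector_Spaces.linear vscale vscale t"
    "Vector_Spaces.linear sl2_scale sl2_scale b" "Vector_Spaces.linear sl2_scale vscale d"
    by (unfold_locales; use f_add f_scale in \<open>simp add: f0 scaleL_pair\<close>)+
  interpret a: Vector_Spaces.linear vscale sl2_scale a by (rule lin)
  interpret t: Vector_Spaces.linear vscale vscale t by (rule lin)
  \<comment> \<open>On two arguments from \<open>sl2\<close> the coboundary is zero, so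
    \<open>b\<close> and \<open>d\<close> are derivations into the adjoint module and into the given
    one; Whitehead's lemma makes both inner.\<close>
  have "b (sl2_br g h) = sl2_br g (b h) - sl2_br h (b g)"
    and "d (sl2_br g h) = act g (d h) - act h (d g)" for g h
    using df[of g 0 h 0]
    by (simp_all add: brL_pair f0 \<phi> act_right br_zero zero_prod_def algebra_simps)
  then obtain u0 u1 where u: "\<And>g. b g = sl2_br g u0" "\<And>g. d g = act g u1"
    using adjoint_derivation_inner[OF lin(3)] derivation_inner_pos[OF lam(1) lin(4)] by metis
  \<comment> \<open>Mixed arguments: \<open>a\<close> is equivariant, and \<open>t\<close> is so up
    to terms in \<open>u0\<close> and \<open>u1\<close>.\<close>
  have equiv: "a (act g w) = sl2_br g (a w)"
    "t (act g w) = act g (t w) + act (sl2_br g u0) w - br w (act g u1)" for g w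
    using df[of g 0 0 w]
    by (simp_all add: brL_pair f0 u \<phi> act_left act_right br_zero adj.act_left adj.act_right
        algebra_simps)
  \<comment> \<open>The map \<open>a\<close> intertwines the Casimir operators, with eigenvalues
    lam(lam + 2) and 8; for positive weights these agree only at 2.\<close>
  have a0: "a w = 0" if "i \<in> I" "w \<in> V i" for i w
  proof -
    have "sl2_scale 8 (a w) = a (casimir w)"
      by (simp add: casimir_adjoint[symmetric] adj.casimir_def casimir_def a.add equiv)
    also have "\<dots> = sl2_scale (of_int (lam i * (lam i + 2))) (a w)"
      using casimir_V[OF that] by (simp only: a.scale)
    finally have "(8 :: complex) = of_int (lam i * (lam i + 2)) \<or> a w = 0"
      by (simp only: adj.G.scale_cancel_right)
    moreover have "(8 :: complex) \<noteq> of_int (lam i * (lam i + 2))"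
    proof
      assume "(8 :: complex) = of_int (lam i * (lam i + 2))"
      then have "of_int 8 = (of_int (lam i * (lam i + 2)) :: complex)"
        by simp
      then have "lam i * (lam i + 2) = 8"
        unfolding of_int_eq_iff by simp
      then have "(lam i - 2) * (lam i + 4) = 0"
        by (simp add: algebra_simps)
      then show False
        using lam(1,2)[OF that(1)] by auto
    qed
    ultimately show ?thesis
      by blast
  qed
  have a0: "a w = 0" for w
    using a.sum[of "\<lambda>i. proj i w" I] a0 proj_in by (simp add: proj_sum)
  \<comment> \<open>\<open>T\<close> is the module block of \<open>f\<close> plus the inner
    derivation by \<open>(u0, u1)\<close>. That sum vanishes on \<open>sl2\<close> and has the same
    coboundary as \<open>f\<close>.\<close>
  define T where "T = (\<lambda>w. t w + act u0 w - br w u1)"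
  have "Vector_Spaces.linear vscale vscale T"
    by unfold_locales
      (simp_all add: T_def t.add t.scale act_right br_linear M.scale_right_distrib
        M.scale_right_diff_distrib)
  moreover have "T (act g w) = act g (T w)" for g w
    by (simp add: T_def equiv act_right act_br_derivation act_br algebra_simps)
  ultimately obtain s where s: "\<And>i x. i \<in> I \<Longrightarrow> x \<in> V i \<Longrightarrow> T x = vscale (s i) x"
    using equivariant_scalars[OF order_less_imp_le[OF lam(1)] lam(3)] finite_dim_V by metis
  have "\<phi> x y = br (T x) y + br x (T y) - T (br x y)" for x y
  proof -
    have "\<phi> x y = br x (t y) - br y (t x) - t (br x y)"
      using df[of 0 x 0 y] by (simp add: brL_pair f0 a0 act_left adj.act_left)
    then show ?thesis
      using br_skew[of y "t x"] br_inner_derivation[of x y u1]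
      by (simp add: T_def br_linear br_diff act_br_derivation algebra_simps)
  qed
  then have "\<phi> x y = vscale (s i + s j - s k) (br x y)"
    if "i \<in> I" "j \<in> I" "k \<in> I" "x \<in> V i" "y \<in> V j" "br x y \<in> V k" for i j k x y
    using that
    by (simp add: s br_linear M.scale_left_distrib M.scale_left_diff_distrib)
  then show ?thesis
    by blast
qed

end

text \<open>If \<open>CE_B2\<close> were the only coset, it would be the class of \<open>f\<close>.
  But \<open>f\<close> lies in its own class, since the zero cochain is a coboundary.\<close>

lemma (in lie_module) CE_H2_nonzeroI:
  assumes "f \<in> CE_Z2 gscale br vscale act" "f \<notin> CE_B2 gscale br vscale act"
  shows "CE_H2 gscale br vscale act \<noteq> {CE_B2 gscale br vscale act}"
proof
  let ?r = "{(f, g). f \<in> CE_Z2 gscale br vscale act \<and> g \<in> CE_Z2 gscale br vscale act \<and>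
               (\<lambda>x y. f x y - g x y) \<in> CE_B2 gscale br vscale act}"
  assume H: "CE_H2 gscale br vscale act = {CE_B2 gscale br vscale act}"
  have "Vector_Spaces.linear gscale vscale (\<lambda>x. 0)"
    by unfold_locales auto
  moreover have "act x 0 = 0" for x
    using act_linear_right Vector_Spaces.linear.axioms(3) module_hom.zero by blast
  ultimately have "(\<lambda>x y. 0) \<in> CE_B2 gscale br vscale act"
    unfolding CE_B2_def CE_C1_def CE_d1_def by (auto intro!: image_eqI[of _ _ "\<lambda>x. 0"])
  then have "f \<in> ?r `` {f}"
    using assms by simp
  moreover have "?r `` {f} = CE_B2 gscale br vscale act"
    using H quotientI[OF assms(1), of ?r] by (simp add: CE_H2_def)
  ultimately show False
    using assms by blast
qed

theorem theorem4p3: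
  fixes n :: nat and m :: int and k :: nat
    and r lam :: "nat \<Rightarrow> int"
    and vscale :: "complex \<Rightarrow> 'v::ab_group_add \<Rightarrow> 'v"
    and act :: "sl2 \<Rightarrow> 'v \<Rightarrow> 'v"
    and br :: "'v \<Rightarrow> 'v \<Rightarrow> 'v"
    and V :: "nat \<Rightarrow> 'v set"
    and scaleL :: "complex \<Rightarrow> sl2 \<times> 'v \<Rightarrow> sl2 \<times> 'v"
    and brL :: "sl2 \<times> 'v \<Rightarrow> sl2 \<times> 'v \<Rightarrow> sl2 \<times> 'v"
  assumes n: "n \<ge> 5"
    and k: "k \<ge> 1"
    and m: "m = 4 * int k"
    and r_distinct: "inj_on r {3..n - 1}"
    and weights:
      "(lam 1 = m \<and> lam 2 = 2 * m - 2 \<and> lam n = 3 * m - 2 \<and>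
        (\<forall>j\<in>{3..n - 1}. lam j = 2 * m + 2 * r j \<and>
            0 \<le> r j \<and> r j \<le> m - 1 \<and> r j \<noteq> m div 2 - 1))
       \<or>
       (lam 1 = m + 2 \<and> lam 2 = 2 * m + 2 \<and> lam n = 3 * m + 2 \<and>
        (\<forall>j\<in>{3..n - 1}. lam j = 2 * m + 2 * r j \<and>
            0 \<le> r j \<and> r j \<le> m + 2 \<and> r j \<noteq> 1 \<and> r j \<noteq> m div 2 + 1))"
    and module: "lie_module sl2_scale sl2_br vscale act"
    and sum: "internal_direct_sum {1..n} V"
    and irr: "\<forall>i\<in>{1..n}. sl2_irr_hw vscale act (lam i) (V i)"
    and scaleL: "scaleL = module_prod.scale sl2_scale vscale"
    and brL: "brL = semidirect_br sl2_br act br"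
    and lie: "lie_algebra scaleL brL"
    and br_11: "bracket_eq vscale act br (V 1) (V 1) (V 2)"
    and br_12: "bracket_eq vscale act br (V 1) (V 2) (V n)"
    and br_jj: "\<forall>j\<in>{3..n - 1}. bracket_eq vscale act br (V j) (V j) (V n)"
    and br_1j: "\<forall>j\<in>{3..n - 1}. bracket_eq vscale act br (V 1) (V j) (V n)"
    and br_other: "\<forall>i\<in>{1..n}. \<forall>j\<in>{1..n}.
      (i, j) \<notin> {(1, 1), (1, 2), (2, 1)} \<union> (\<Union>l\<in>{3..n - 1}. {(l, l), (1, l), (l, 1)}) \<longrightarrow>
      (\<forall>x\<in>V i. \<forall>y\<in>V j. br x y = 0)"
  shows "CE_H2 scaleL brL scaleL brL \<noteq> {CE_B2 scaleL brL scaleL brL}"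
proof -
  \<comment> \<open>Keeps the index 1 from being rewritten to \<open>Suc 0\<close>, so that facts
    about \<open>V 1\<close> and \<open>lam 1\<close> match.\<close>
  note [simp del] = One_nat_def
  let ?I = "{1..n}"
  interpret decomposed_sl2_semidirect vscale act br ?I V lam
    using module lie sum irr
    by (intro decomposed_sl2_semidirect.intro sl2_semidirect.intro decomposed_sl2_module.intro
        sl2_module.intro sl2_semidirect_axioms.intro decomposed_sl2_module_axioms.intro)
      (auto simp: scaleL brL)
  have n_in: "n \<in> ?I" and in_I: "1 \<in> ?I" "2 \<in> ?I" "3 \<in> ?I" "4 \<in> ?I"
    and mid: "3 \<in> {3..n - 1}" "4 \<in> {3..n - 1}"
    using n by auto

  \<comment> \<open>The weights are distinct and exceed 2\<close>
  have m4: "m \<ge> 4"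
    using k m by simp
  have weight_cases: "i = 1 \<or> i = 2 \<or> i = n \<or> i \<in> {3..n - 1}" if "i \<in> ?I" for i
    using that by auto
  \<comment> \<open>The excluded values of \<open>r j\<close> are coincidences: m/2 - 1 would give
    \<open>lam n\<close> in the first sequence; in the second, 1 would give \<open>lam 2\<close> and
    m/2 + 1 would give \<open>lam n\<close>.\<close>
  have lam_mid: "lam j = 2 * m + 2 * r j" "r j \<ge> 0" "lam j \<noteq> lam n" "lam j \<noteq> lam 2" "lam j \<noteq> lam 1"
    if "j \<in> {3..n - 1}" for j
  proof -
    have half: "m div 2 = 2 * int k"
      using m by simp
    from weights that show "lam j = 2 * m + 2 * r j" "r j \<ge> 0"
      by auto
    from weights that
    have "lam 1 = m \<and> lam 2 = 2 * m - 2 \<and> lam n = 3 * m - 2 \<and> r j \<noteq> m div 2 - 1 \<or>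
        lam 1 = m + 2 \<and> lam 2 = 2 * m + 2 \<and> lam n = 3 * m + 2 \<and> r j \<noteq> 1 \<and> r j \<noteq> m div 2 + 1"
      by blast
    then show "lam j \<noteq> lam n" "lam j \<noteq> lam 2" "lam j \<noteq> lam 1"
      unfolding half using \<open>lam j = 2 * m + 2 * r j\<close> \<open>r j \<ge> 0\<close> m m4 by presburger+
  qed
  have lam_end: "lam 1 > 2" "lam 2 > lam 1" "lam n > lam 2"
    using weights m4 by auto
  have lam_gt: "lam i > 2" if "i \<in> ?I" for i
    using weight_cases[OF that] lam_end lam_mid(1,2)[of i] m4 by auto
  have lam_inj: "inj_on lam ?I"
  proof (rule inj_onI)
    fix i j assume ij: "i \<in> ?I" "j \<in> ?I" "lam i = lam j"
    consider "i \<in> {3..n - 1}" "j \<in> {3..n - 1}" | "i \<in> {3..n - 1}" "j \<in> {1, 2, n}"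
      | "i \<in> {1, 2, n}" "j \<in> {3..n - 1}" | "i \<in> {1, 2, n}" "j \<in> {1, 2, n}"
      using weight_cases[OF ij(1)] weight_cases[OF ij(2)] by blast
    then show "i = j"
    proof cases
      case 1
      then have "r i = r j"
        using ij(3) lam_mid(1) by force
      with 1 show ?thesis
        using r_distinct by (auto dest: inj_onD)
    next
      case 2
      then show ?thesis
        using lam_mid(3-5)[OF 2(1)] ij(3) by auto
    next
      case 3
      then show ?thesis
        using lam_mid(3-5)[OF 3(2)] ij(3) by auto
    next
      case 4
      then show ?thesis
        using lam_end ij(3) by auto
    qed
  qed

  \<comment> \<open>Annihilator and image of the bracket\<close>
  have br_other: "br x y = 0"
    if "i \<in> ?I" "j \<in> ?I" "x \<in> V i" "y \<in> V j"
      "(i, j) \<notin> {(1, 1), (1, 2), (2, 1)} \<union> (\<Union>l\<in>{3..n - 1}. {(l, l), (1, l), (l, 1)})" for i j x y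
    using br_other that by blast
  have br_mem: "br x y \<in> V k" if "bracket_eq vscale act br (V i) (V j) (V k)" "x \<in> V i" "y \<in> V j"
    for i j k x y
  proof -
    have "br x y \<in> M.span {br x y |x y. x \<in> V i \<and> y \<in> V j}"
      using that by (blast intro: M.span_base)
    with that(1) show ?thesis
      by (simp add: bracket_eq_def)
  qed
  \<comment> \<open>No listed pair contains \<open>n\<close>, so the whole module annihilates
    \<open>V n\<close>, where the cocycle takes its values.\<close>
  have br_Vn: "br x y = 0" if "y \<in> V n" for x y
  proof -
    have "br (proj i x) y = 0" if "i \<in> ?I" for i
      by (rule br_other[OF that n_in proj_in[OF that] \<open>y \<in> V n\<close>]) (use n in auto)
    then show ?thesis
      using br_sum(1)[of "\<lambda>i. proj i x" ?I y] by (simp add: proj_sum)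
  qed
  \<comment> \<open>All brackets lie in the sum of \<open>V 2\<close> and \<open>V n\<close>, so
    their components at 1 and 3, the ones the cocycle reads, are zero.\<close>
  have proj_br: "proj l (br x y) = 0" if l: "l \<in> {1, 3}" for l x y
  proof -
    have lI: "l \<in> ?I"
      using l n by auto
    interpret P: Vector_Spaces.linear vscale vscale "proj l" by (rule proj_linear[OF lI])
    have "proj l (br x y) = 0" if ij: "i \<in> ?I" "j \<in> ?I" and xy: "x \<in> V i" "y \<in> V j" for i j x y
    proof -
      have "br x y \<in> V 2 \<or> br x y \<in> V n \<or> br x y = 0"
      proof (cases "(i, j) \<in> {(1, 1), (1, 2), (2, 1)} \<union> (\<Union>l\<in>{3..n - 1}. {(l, l), (1, l), (l, 1)})")
        case True
        \<comment> \<open>The bracket relations name each mixed pair in one order; skew symmetry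
          gives the other.\<close>
        have swap: "br x y \<in> V n" if "br y x \<in> V n"
          using br_skew[of x y] M.subspace_neg[OF subspace_V[OF n_in] that] by simp
        from True consider "(i, j) = (1, 1)" | "(i, j) = (1, 2)" | "(j, i) = (1, 2)"
          | "i \<in> {3..n - 1}" "i = j" | "i = 1" "j \<in> {3..n - 1}" | "j = 1" "i \<in> {3..n - 1}"
          by auto
        then show ?thesis
          using xy br_mem[OF br_11] br_mem[OF br_12] br_mem[OF br_jj[rule_format]]
            br_mem[OF br_1j[rule_format]] swap
          by cases auto
      next
        case False
        then show ?thesis
          using br_other[OF ij xy] by simp
      qed
      then show ?thesis
        using proj_V[OF lI in_I(2)] proj_V[OF lI n_in] l n by (auto simp: proj_zero in_I)
    qed
    then have "proj l (\<Sum>i\<in>?I. \<Sum>j\<in>?I. br (proj i x) (proj j y)) = 0"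
      by (simp add: P.sum proj_in)
    then show ?thesis
      by (simp add: br_sum[symmetric] proj_sum)
  qed

  \<comment> \<open>The cocycle\<close>
  define \<phi> where "\<phi> = (\<lambda>x y. br (proj 1 x) (proj 3 y) + br (proj 3 x) (proj 1 y))"
  \<comment> \<open>The second summand of \<phi> makes it alternating; its values lie in
    \<open>V n\<close> by skew symmetry.\<close>
  have \<phi>_Vn: "\<phi> x y \<in> V n" for x y
  proof -
    have mem: "br u v \<in> V n" if "u \<in> V 1" "v \<in> V 3" for u v
      using br_mem[OF br_1j[rule_format, OF mid(1)]] that by blast
    then have "br v u \<in> V n" if "u \<in> V 1" "v \<in> V 3" for u v
      using br_skew[of v u] M.subspace_neg[OF subspace_V[OF n_in]] that by simp
    with mem show ?thesis
      unfolding \<phi>_def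
      by (intro M.subspace_add[OF subspace_V[OF n_in]]) (simp_all only: proj_in in_I)
  qed
  let ?\<Phi> = "\<lambda>(g :: sl2, x) (h :: sl2, y). (0 :: sl2, \<phi> x y)"
  have proj13: "proj l (x + y) = proj l x + proj l y" "proj l (vscale c x) = vscale c (proj l x)"
    "proj l (act g x) = act g (proj l x)" if "l \<in> {1, 3}" for l x y c g
    using that in_I proj_add proj_scale proj_act by auto
  have "?\<Phi> \<in> CE_Z2 scaleL brL scaleL brL"
    unfolding scaleL brL
  proof (rule cocycle_extension)
    show "Vector_Spaces.linear vscale vscale (\<phi> x)" "Vector_Spaces.linear vscale vscale (\<lambda>x. \<phi> x y)"
      for x y
      by (unfold_locales; simp add: \<phi>_def proj13 br_linear M.scale_right_distrib)+
    show "\<phi> x x = 0" for x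
      using br_skew[of "proj 3 x" "proj 1 x"] by (simp add: \<phi>_def)
    show "act g (\<phi> x y) = \<phi> (act g x) y + \<phi> x (act g y)" for g x y
      by (simp add: \<phi>_def proj13 act_right act_br_derivation)
    show "br x (\<phi> y z) = 0" for x y z
      by (rule br_Vn[OF \<phi>_Vn])
    show "\<phi> (br x y) z = 0" for x y z
      by (simp add: \<phi>_def proj_br br_zero)
  qed

  \<comment> \<open>The cocycle is not a coboundary\<close>
  moreover have "?\<Phi> \<notin> CE_B2 scaleL brL scaleL brL"
  proof
    assume "?\<Phi> \<in> CE_B2 scaleL brL scaleL brL"
    then have B: "?\<Phi> \<in> CE_B2 (semidirect_scale vscale) (semidirect_br sl2_br act br)
        (semidirect_scale vscale) (semidirect_br sl2_br act br)"
      by (simp only: scaleL brL)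
    have lam_pos: "lam i > 0" "lam i \<noteq> 2" if "i \<in> ?I" for i
      using lam_gt[OF that] by auto
    have \<phi>_zero: "\<phi> x 0 = 0" "\<phi> 0 x = 0" for x
      using proj_zero[OF in_I(1)] proj_zero[OF in_I(3)] by (simp_all add: \<phi>_def br_zero)
    obtain s where s: "\<forall>i\<in>?I. \<forall>j\<in>?I. \<forall>k\<in>?I. \<forall>x\<in>V i. \<forall>y\<in>V j. br x y \<in> V k \<longrightarrow>
        \<phi> x y = vscale (s i + s j - s k) (br x y)"
      using coboundary_scalars[OF lam_pos lam_inj \<phi>_zero B] by blast
    have relation: "s i + s j - s k = c"
      if ijk: "bracket_eq vscale act br (V i) (V j) (V k)" "i \<in> ?I" "j \<in> ?I" "k \<in> ?I"
        and c: "\<And>x y. x \<in> V i \<Longrightarrow> y \<in> V j \<Longrightarrow> \<phi> x y = vscale c (br x y)" for i j k c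
    proof -
      obtain x y where xy: "x \<in> V i" "y \<in> V j" "br x y \<noteq> 0"
        using ijk(1) by (auto simp: bracket_eq_def)
      then have "vscale (s i + s j - s k) (br x y) = vscale c (br x y)"
        using s br_mem[OF ijk(1)] c ijk(2-4) by metis
      then show ?thesis
        using xy(3) by (simp only: M.scale_cancel_right) simp
    qed
    have \<phi>_V: "\<phi> x y = vscale (if i = 1 \<and> j = 3 \<or> i = 3 \<and> j = 1 then 1 else 0) (br x y)"
      if "i \<in> ?I" "j \<in> ?I" "x \<in> V i" "y \<in> V j" for i j x y
      using proj_V[OF in_I(1) that(1,3)] proj_V[OF in_I(1) that(2,4)]
        proj_V[OF in_I(3) that(1,3)] proj_V[OF in_I(3) that(2,4)]
      by (simp add: \<phi>_def br_zero)
    have "s 1 + s 1 - s 2 = 0"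
      by (rule relation[OF br_11]) (use in_I n_in \<phi>_V[OF in_I(1) in_I(1)] in simp_all)
    moreover have "s 1 + s 2 - s n = 0"
      by (rule relation[OF br_12]) (use in_I n_in \<phi>_V[OF in_I(1) in_I(2)] in simp_all)
    moreover have "s 3 + s 3 - s n = 0"
      by (rule relation[OF br_jj[rule_format, OF mid(1)]]) (use in_I n_in \<phi>_V[OF in_I(3) in_I(3)] in simp_all)
    moreover have "s 4 + s 4 - s n = 0"
      by (rule relation[OF br_jj[rule_format, OF mid(2)]]) (use in_I n_in \<phi>_V[OF in_I(4) in_I(4)] in simp_all)
    moreover have "s 1 + s 4 - s n = 0"
      by (rule relation[OF br_1j[rule_format, OF mid(2)]]) (use in_I n_in \<phi>_V[OF in_I(1) in_I(4)] in simp_all)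
    moreover have "s 1 + s 3 - s n = 1"
      by (rule relation[OF br_1j[rule_format, OF mid(1)]]) (use in_I n_in \<phi>_V[OF in_I(1) in_I(3)] in simp_all)
    \<comment> \<open>The first two equations make \<open>s n\<close> three times
      \<open>s 1\<close>, those with index 4 make it twice \<open>s 1\<close>.\<close>
    ultimately show False
      by algebra
  qed
  ultimately show ?thesis
    by (rule lie_module.CE_H2_nonzeroI[OF lie_algebra.adjoint_module[OF lie]])
qed

end
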